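(* Let $\mathfrak{Z}$ be an $\mathbb{F}$-Fréchet space and let $(M_i,\mathcal{M}_i,\mu_i)$, $i=1,2$, be two arbitrary $\sigma$-finite measure spaces. Set $(M,\mathcal{M},\mu):=(M_1\times M_2,\mathcal{M}_1\otimes\mathcal{M}_2,\mu_1\otimes\mu_2)$. Let $\psi:M\to\mathfrak{Z}'$ be $\mathfrak{Z}'$-Gelfand $\mu$-integrable. Then $$\int_{M_1}\int_{M_2}\langle\psi(x_1,x_2),\cdot\rangle\,\mu_2(dx_2)\,\mu_1(dx_1)=\int_M\psi(x)\,\mu(dx)=\int_{M_2}\int_{M_1}\langle\psi(x_1,x_2),\cdot\rangle\,\mu_1(dx_1)\,\mu_2(dx_2)$$ as elements of $\mathfrak{Z}'$, where the first and third expressions denote the functionals $z\mapsto\int_{M_1}\int_{M_2}\langle\psi(x_1,x_2),z\rangle\,\mu_2(dx_2)\,\mu_1(dx_1)$ and $z\mapsto\int_{M_2}\int_{M_1}\langle\psi(x_1,x_2),z\rangle\,\mu_1(dx_1)\,\mu_2(dx_2)$ on $\mathfrak{Z}$.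
   Context: $\mathbb{F}\in\{\mathbb{R},\mathbb{C}\}$. A Fréchet space is a metrizable, complete, locally convex topological vector space over $\mathbb{F}$; $\mathfrak{Z}'$ is its topological dual and $\langle z',z\rangle$ the dual pairing of $z'\in\mathfrak{Z}'$, $z\in\mathfrak{Z}$. For a $\sigma$-finite measure space $(M,\mathcal{M},\mu)$, a map $\psi:M\to\mathfrak{Z}'$ is $\mathfrak{Z}'$-Gelfand $\mu$-integrable if $x\mapsto\langle\psi(x),z\rangle$ belongs to $L^1(\mu)$ for every $z\in\mathfrak{Z}$. For such $\psi$ and $E\in\mathcal{M}$, the Gelfand integral $\int_E\psi(x)\,\mu(dx)$ is the element of $\mathfrak{Z}'$ given by $z\mapsto\int_E\langle\psi(x),z\rangle\,\mu(dx)$ (this functional is continuous). Inner integrals in iterated integrals of scalar functions are defined almost everywhere, as in the classical Fubini theorem. *)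

theory Defs
  imports "HOL-Analysis.Analysis"
begin

text \<open>
  The scalar field \<open>\<bbbF> \<in> {\<real>, \<complex>}\<close> is a type class: a normed field isometrically isomorphic to
  \<open>\<real>\<close> or to \<open>\<complex>\<close>. The superclasses \<open>banach\<close> and \<open>second_countable_topology\<close> are what the
  Bochner integral asks of its value type.
\<close>

class real_or_complex = real_normed_field + banach + second_countable_topology +
  assumes real_or_complex:
    "\<exists>\<phi> :: 'a \<Rightarrow> complex.
       (\<forall>x y. \<phi> (x + y) = \<phi> x + \<phi> y) \<and> (\<forall>x y. \<phi> (x * y) = \<phi> x * \<phi> y) \<and>
       (\<forall>r x. \<phi> (scaleR r x) = scaleR r (\<phi> x)) \<and> (\<forall>x. cmod (\<phi> x) = norm x) \<and>
       (range \<phi> = \<real> \<or> range \<phi> = UNIV)"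

instance real :: real_or_complex
  by standard (rule exI[of _ complex_of_real],
      auto simp: Reals_def scaleR_conv_of_real)

instance complex :: real_or_complex
  by standard (rule exI[of _ "\<lambda>x. x"], auto)

definition scalar_convex :: "('k::real_normed_field \<Rightarrow> 'z \<Rightarrow> 'z::ab_group_add) \<Rightarrow> 'z set \<Rightarrow> bool"
  where "scalar_convex smul V \<longleftrightarrow>
    (\<forall>x\<in>V. \<forall>y\<in>V. \<forall>u\<ge>0. \<forall>v\<ge>0. u + v = 1 \<longrightarrow>
       smul (of_real u) x + smul (of_real v) y \<in> V)"

text \<open>
  Continuity of addition is part of the class \<open>uniform_topological_group_add\<close>. The class also forces
  the uniformity to be the translation-invariant one induced by the topology
  (\<open>uniformity = filtercomap (\<lambda>(x, y). y - x) (nhds 0)\<close>), so it is no additional structure, and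
  \<open>complete UNIV\<close> says that every Cauchy filter of the topological vector space converges.
\<close>

locale frechet_space = vector_space smul
  for smul :: "'k::real_or_complex \<Rightarrow> 'z \<Rightarrow> 'z::{ab_group_add, uniform_topological_group_add}" +
  assumes continuous_scale: "continuous_on UNIV (\<lambda>(a, x). smul a x)"
    and metrizable: "metrizable_space (euclidean :: 'z topology)"
    and complete: "complete (UNIV :: 'z set)"
    and locally_convex: "\<And>U. open U \<Longrightarrow> 0 \<in> U \<Longrightarrow> \<exists>V. open V \<and> scalar_convex smul V \<and> 0 \<in> V \<and> V \<subseteq> U"

definition topological_dual ::
    "('k::real_normed_field \<Rightarrow> 'z \<Rightarrow> 'z::{ab_group_add, topological_space}) \<Rightarrow> ('z \<Rightarrow> 'k) set"
  where "topological_dual smul = {f. Vector_Spaces.linear smul (*) f \<and> continuous_on UNIV f}"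

text \<open>The dual pairing of \<open>f\<close> and \<open>z\<close> is function application \<open>f z\<close>.\<close>

definition gelfand_integrable ::
    "('k::real_or_complex \<Rightarrow> 'z \<Rightarrow> 'z::{ab_group_add, topological_space}) \<Rightarrow> 'a measure \<Rightarrow>
     ('a \<Rightarrow> 'z \<Rightarrow> 'k) \<Rightarrow> bool"
  where "gelfand_integrable smul M \<psi> \<longleftrightarrow>
    \<psi> \<in> space M \<rightarrow> topological_dual smul \<and> (\<forall>z. integrable M (\<lambda>x. \<psi> x z))"

definition gelfand_integral ::
    "'a measure \<Rightarrow> 'a set \<Rightarrow> ('a \<Rightarrow> 'z \<Rightarrow> 'k::real_or_complex) \<Rightarrow> 'z \<Rightarrow> 'k"
  where "gelfand_integral M E \<psi> = (\<lambda>z. LINT x:E|M. \<psi> x z)"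

end

theory Submission
  imports Defs
begin

text \<open>
  Everything except membership in the dual is the scalar Fubini theorem applied to
  \<open>\<lambda>x. \<psi> x z\<close> for each fixed \<open>z\<close>: it gives the equality of the three functionals, so only one of
  them has to be shown continuous.

  Continuity of \<open>z \<mapsto> \<integral>\<^sub>E \<langle>\<psi>(x), z\<rangle> \<mu>(dx)\<close> follows from a Baire category argument for the extended
  seminorm \<open>p(z) = \<integral> |\<langle>\<psi>(x), z\<rangle>| \<mu>(dx)\<close>, which is finite everywhere by Gelfand integrability. By
  Fatou's lemma \<open>p\<close> is lower semicontinuous along sequences, hence, the topology being metrizable,
  the sets \<open>{z. p z \<le> n}\<close> are closed (lemma \<open>closed_dual_integral_le\<close>). They cover
  the space, so one of them contains a non-empty open set
  (lemma \<open>baire_complete_metrizable_group\<close>). Translating this set to the origin bounds \<open>p\<close> on a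
  neighbourhood of \<open>0\<close>, and a linear functional dominated by \<open>p\<close> is then continuous
  (lemma \<open>gelfand_integral_in_topological_dual\<close>).
\<close>

section \<open>Baire category in complete metrizable topological groups\<close>

text \<open>
  Completeness refers to the uniformity of the group, not to any metric that induces the topology:
  the metrics supplied by \<open>metrizable_space\<close> need be neither translation-invariant nor complete.
  A metric is therefore used only for regularity and for a countable base of neighbourhoods
  of \<open>0\<close>.
\<close>

lemma baire_complete_metrizable_group:
  fixes A :: "nat \<Rightarrow> 'z::uniform_topological_group_add set"
  assumes metr: "metrizable_space (euclidean :: 'z topology)"
    and compl: "complete (UNIV :: 'z set)"
    and closed: "\<And>n. closed (A n)"
    and cover: "(\<Union>n. A n) = UNIV"
  shows "\<exists>n. interior (A n) \<noteq> {}"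
proof (rule ccontr)
  assume "\<not> ?thesis"
  then have int: "interior (A n) = {}" for n by blast
  obtain M :: "'z set" and d where "Metric_space M d"
    and eq: "(euclidean :: 'z topology) = Metric_space.mtopology M d"
    using metr unfolding metrizable_space_def by blast
  then interpret Metric_space M d by simp
  have M: "M = UNIV"
    using topspace_mtopology unfolding eq[symmetric] by simp
  have open_iff: "open U \<longleftrightarrow> openin mtopology U" for U :: "'z set"
    unfolding eq[symmetric] by simp
  define B where "B n = mball 0 (1 / real (Suc n))" for n :: nat
  have B: "open (B n)" "0 \<in> B n" for n
    by (simp_all only: B_def open_iff openin_mball centre_in_mball_iff) (simp add: M)
  have B_base: "\<exists>n. B n \<subseteq> U" if U: "open U" "0 \<in> U" for U
  proof -
    obtain r where r: "r > 0" "mball 0 r \<subseteq> U"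
      using U unfolding open_iff openin_mtopology by blast
    obtain n where "1 / real (Suc n) < r"
      using reals_Archimedean[OF r(1)] by (auto simp: inverse_eq_divide)
    then have "B n \<subseteq> mball 0 r"
      unfolding B_def by (intro mball_subset_concentric) auto
    with r(2) show ?thesis by blast
  qed
  have regular: "\<exists>U V. open U \<and> closed V \<and> x \<in> U \<and> U \<subseteq> V \<and> V \<subseteq> W"
    if "open W" "x \<in> W" for W and x :: 'z
  proof -
    obtain r where r: "r > 0" "mcball x r \<subseteq> W"
      using \<open>open W\<close> \<open>x \<in> W\<close> unfolding open_iff openin_mtopology_mcball by blast
    have "closedin euclidean (mcball x r)"
      unfolding eq by simp
    then have "closed (mcball x r)" by simp
    moreover have "open (mball x r)" by (simp add: open_iff)
    moreover have "x \<in> mball x r" using r(1) by (simp only: centre_in_mball_iff) (simp add: M)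
    ultimately show ?thesis
      using r(2) mball_subset_mcball[of x r] by (intro exI conjI)
  qed
  \<comment> \<open>Each open set is replaced by a smaller one that avoids \<open>A n\<close> even in the closure and is
    small of order \<open>B n\<close>; the latter makes the filter of the resulting nested sets Cauchy.\<close>
  have step: "\<exists>G'. (open G' \<and> G' \<noteq> {}) \<and>
      (\<exists>V. closed V \<and> G' \<subseteq> V \<and> V \<subseteq> G - A n) \<and> (\<forall>x\<in>G'. \<forall>y\<in>G'. y - x \<in> B n)"
    if G: "open G \<and> G \<noteq> {}" for G n
  proof -
    have "\<not> G \<subseteq> A n" using int[of n] G interior_maximal[of G "A n"] by blast
    then obtain a where a: "a \<in> G - A n" by blast
    have "((\<lambda>(x, y). y - x) \<longlongrightarrow> a - a) (nhds (a :: 'z) \<times>\<^sub>F nhds a)"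
      unfolding case_prod_unfold
      by (intro tendsto_diff filterlim_fst filterlim_snd)
    then have "\<forall>\<^sub>F p in nhds a \<times>\<^sub>F nhds a. (case p of (x, y) \<Rightarrow> y - x) \<in> B n"
      by (rule topological_tendstoD) (use B in auto)
    then obtain Q where Q: "eventually Q (nhds a)" "\<And>x y. Q x \<Longrightarrow> Q y \<Longrightarrow> y - x \<in> B n"
      unfolding eventually_prod_same by auto
    obtain W where W: "open W" "a \<in> W" "\<And>x. x \<in> W \<Longrightarrow> Q x"
      using Q(1) unfolding eventually_nhds by blast
    have "open (W \<inter> (G - A n))" using W(1) G closed by (intro open_Int open_Diff) auto
    then obtain U V where UV: "open U" "closed V" "a \<in> U" "U \<subseteq> V" "V \<subseteq> W \<inter> (G - A n)"
      using regular[of "W \<inter> (G - A n)" a] W(2) a by blast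
    show ?thesis
    proof (rule exI[of _ U], intro conjI exI[of _ V] ballI)
      show "y - x \<in> B n" if "x \<in> U" "y \<in> U" for x y
        using that UV(4,5) W(3) Q(2) by blast
    qed (use UV in auto)
  qed
  have "\<exists>G. \<forall>n. (open (G n) \<and> G n \<noteq> {}) \<and>
      (\<exists>V. closed V \<and> G (Suc n) \<subseteq> V \<and> V \<subseteq> G n - A n) \<and>
      (\<forall>x\<in>G (Suc n). \<forall>y\<in>G (Suc n). y - x \<in> B n)"
  proof (rule dependent_nat_choice)
    show "\<exists>G :: 'z set. open G \<and> G \<noteq> {}" by (intro exI[of _ UNIV]) simp
  qed (rule step)
  then obtain G where G: "\<And>n. open (G n) \<and> G n \<noteq> {}"
      "\<And>n. \<exists>V. closed V \<and> G (Suc n) \<subseteq> V \<and> V \<subseteq> G n - A n"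
      "\<And>n x y. x \<in> G (Suc n) \<Longrightarrow> y \<in> G (Suc n) \<Longrightarrow> y - x \<in> B n"
    by metis
  have "G (Suc n) \<subseteq> G n" for n using G(2)[of n] by blast
  then have dec: "G n \<subseteq> G m" if "m \<le> n" for m n
    using that by (rule lift_Suc_antimono_le)
  define F where "F = (INF n. principal (G n))"
  have ev_F: "eventually P F \<longleftrightarrow> (\<exists>n. \<forall>x\<in>G n. P x)" for P
    unfolding F_def
  proof (subst eventually_INF_base)
    show "\<exists>x\<in>UNIV. principal (G x) \<le> inf (principal (G a)) (principal (G b))" for a b
      using dec[of a "max a b"] dec[of b "max a b"] by (intro bexI[of _ "max a b"]) auto
  qed (auto simp: eventually_principal)
  have "F \<noteq> bot"
    using G(1) unfolding trivial_limit_def ev_F by blast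
  moreover have "cauchy_filter F"
    unfolding cauchy_filter_def le_filter_def
  proof (intro allI impI)
    fix P :: "'z \<times> 'z \<Rightarrow> bool" assume "eventually P uniformity"
    then obtain Q where Q: "eventually Q (nhds 0)" "\<And>x y. Q (y - x) \<Longrightarrow> P (x, y)"
      unfolding cauchy_seq_finset_iff_vanishing eventually_filtercomap by auto
    obtain U where U: "open U" "0 \<in> U" "\<And>x. x \<in> U \<Longrightarrow> Q x"
      using Q(1) unfolding eventually_nhds by blast
    then obtain n where n: "\<And>x. x \<in> B n \<Longrightarrow> Q x"
      using B_base[OF U(1,2)] by blast
    have "P (x, y)" if "x \<in> G (Suc n)" "y \<in> G (Suc n)" for x y
      using that by (intro Q(2) n G(3))
    moreover have "eventually (\<lambda>x. x \<in> G (Suc n)) F" unfolding ev_F by blast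
    ultimately show "eventually P (F \<times>\<^sub>F F)"
      unfolding eventually_prod_same by blast
  qed
  ultimately obtain x where x: "F \<le> nhds x"
    using cauchy_filter_complete_converges[OF _ compl, of F] by auto
  have "x \<notin> A n" for n
  proof -
    obtain V where V: "closed V" "G (Suc n) \<subseteq> V" "V \<subseteq> G n - A n" using G(2) by blast
    have "eventually (\<lambda>y. y \<in> V) F" unfolding ev_F using V(2) by blast
    then have "x \<in> V"
      using Lim_in_closed_set[OF V(1) _ \<open>F \<noteq> bot\<close>, of "\<lambda>y. y"] x
      by (simp add: filterlim_def)
    with V(3) show ?thesis by blast
  qed
  with cover show False by blast
qed

section \<open>Continuity of the Gelfand integral\<close>

text \<open>Lower semicontinuity of \<open>z \<mapsto> \<integral> |\<langle>\<psi>(x), z\<rangle>| \<mu>(dx)\<close>, by Fatou's lemma.\<close>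

lemma closed_dual_integral_le:
  fixes smul :: "'k::real_or_complex \<Rightarrow> 'z \<Rightarrow> 'z::{ab_group_add, topological_space}"
  assumes metr: "metrizable_space (euclidean :: 'z topology)"
    and \<psi>: "\<psi> \<in> space M \<rightarrow> topological_dual smul"
    and meas: "\<And>z. (\<lambda>x. \<psi> x z) \<in> borel_measurable M"
  shows "closed {z. (\<integral>\<^sup>+x. ennreal (norm (\<psi> x z)) \<partial>M) \<le> c}"
    (is "closed ?S")
proof -
  obtain X :: "'z set" and d where "Metric_space X d"
    and eq: "(euclidean :: 'z topology) = Metric_space.mtopology X d"
    using metr unfolding metrizable_space_def by blast
  then interpret Metric_space X d by simp
  have X: "X = UNIV"
    using topspace_mtopology unfolding eq[symmetric] by simp
  have "l \<in> ?S" if \<sigma>: "range \<sigma> \<subseteq> ?S" and "limitin euclidean \<sigma> l sequentially" for \<sigma> l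
  proof -
    have lim: "\<sigma> \<longlonglongrightarrow> l" using that(2) by simp
    have "(\<lambda>n. ennreal (norm (\<psi> x (\<sigma> n)))) \<longlonglongrightarrow> ennreal (norm (\<psi> x l))" if "x \<in> space M" for x
    proof -
      have "continuous_on UNIV (\<psi> x)"
        using \<psi> that unfolding topological_dual_def by blast
      then have "(\<lambda>n. \<psi> x (\<sigma> n)) \<longlonglongrightarrow> \<psi> x l"
        using lim by (rule continuous_on_tendsto_compose) auto
      then show ?thesis by (intro tendsto_ennrealI tendsto_norm)
    qed
    then have "(\<integral>\<^sup>+x. ennreal (norm (\<psi> x l)) \<partial>M) =
        (\<integral>\<^sup>+x. liminf (\<lambda>n. ennreal (norm (\<psi> x (\<sigma> n)))) \<partial>M)"
      by (intro nn_integral_cong lim_imp_Liminf[symmetric]) auto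
    also have "\<dots> \<le> liminf (\<lambda>n. \<integral>\<^sup>+x. ennreal (norm (\<psi> x (\<sigma> n))) \<partial>M)"
      using meas by (intro nn_integral_liminf) measurable
    also have "\<dots> \<le> limsup (\<lambda>n. \<integral>\<^sup>+x. ennreal (norm (\<psi> x (\<sigma> n))) \<partial>M)"
      by (rule Liminf_le_Limsup) simp
    also have "\<dots> \<le> c"
      using \<sigma> by (intro Limsup_bounded always_eventually) auto
    finally show ?thesis by simp
  qed
  then have "closedin mtopology ?S"
    unfolding metric_closedin_iff_sequentially_closed unfolding eq[symmetric]
    by (intro conjI allI impI) (simp add: X, elim conjE)
  then show ?thesis unfolding eq[symmetric] by simp
qed

lemma gelfand_integral_in_topological_dual:
  fixes smul :: "'k::real_or_complex \<Rightarrow> 'z \<Rightarrow> 'z::{ab_group_add, uniform_topological_group_add}"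
  assumes "frechet_space smul"
    and gelf: "gelfand_integrable smul M \<psi>"
    and E: "E \<in> sets M"
  shows "gelfand_integral M E \<psi> \<in> topological_dual smul"
proof -
  interpret frechet_space smul by fact
  have \<psi>: "\<psi> \<in> space M \<rightarrow> topological_dual smul" and int: "\<And>z. integrable M (\<lambda>x. \<psi> x z)"
    using gelf unfolding gelfand_integrable_def by auto
  have lin: "Vector_Spaces.linear smul (*) (\<psi> x)" if "x \<in> space M" for x
    using \<psi> that unfolding topological_dual_def by blast
  have add: "\<psi> x (y + z) = \<psi> x y + \<psi> x z" and scale: "\<psi> x (smul c z) = c * \<psi> x z"
    if "x \<in> space M" for x y z c
    using lin[OF that] unfolding Vector_Spaces.linear_iff by auto
  have diff: "\<psi> x (y - z) = \<psi> x y - \<psi> x z" if "x \<in> space M" for x y z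
    using add[OF that, of "y - z" z] by (simp add: algebra_simps)
  define p where "p z = (LINT x|M. norm (\<psi> x z))" for z
  define T where "T = gelfand_integral M E \<psi>"
  have int_E: "set_integrable M E (\<lambda>x. \<psi> x z)" for z
    unfolding set_integrable_def by (rule integrable_mult_indicator[OF E int])
  have T_add: "T (y + z) = T y + T z" for y z
  proof -
    have "T (y + z) = (LINT x:E|M. \<psi> x y + \<psi> x z)"
      unfolding T_def gelfand_integral_def set_lebesgue_integral_def
      by (intro Bochner_Integration.integral_cong) (auto simp: add)
    then show ?thesis
      using int_E by (simp add: T_def gelfand_integral_def)
  qed
  have T_scale: "T (smul c z) = c * T z" for c z
  proof -
    have "T (smul c z) = (LINT x:E|M. c * \<psi> x z)"
      unfolding T_def gelfand_integral_def set_lebesgue_integral_def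
      by (intro Bochner_Integration.integral_cong) (auto simp: scale)
    then show ?thesis by (simp add: T_def gelfand_integral_def)
  qed
  have T_diff: "T (y - z) = T y - T z" for y z
    using T_add[of "y - z" z] by (simp add: algebra_simps)
  have T_le: "norm (T z) \<le> p z" for z
  proof -
    have "norm (T z) \<le> (LINT x|M. norm (indicator E x *\<^sub>R \<psi> x z))"
      unfolding T_def gelfand_integral_def set_lebesgue_integral_def
      by (rule integral_norm_bound)
    also have "\<dots> \<le> p z"
      unfolding p_def using int_E[unfolded set_integrable_def] int
      by (intro integral_mono integrable_norm) (auto simp: indicator_def)
    finally show ?thesis .
  qed
  have p_scale: "p (smul c z) = norm c * p z" for c z
  proof -
    have "p (smul c z) = (LINT x|M. norm c * norm (\<psi> x z))"
      unfolding p_def by (intro Bochner_Integration.integral_cong) (auto simp: scale norm_mult)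
    then show ?thesis by (simp add: p_def)
  qed
  have p_diff: "p (y - z) \<le> p y + p z" for y z
  proof -
    have "p (y - z) \<le> (LINT x|M. norm (\<psi> x y) + norm (\<psi> x z))"
      unfolding p_def using int
      by (intro integral_mono integrable_norm Bochner_Integration.integrable_add)
        (auto simp: diff norm_triangle_ineq4)
    then show ?thesis using int by (simp add: p_def)
  qed
  define A where "A n = {z. p z \<le> real n}" for n
  have "A n = {z. (\<integral>\<^sup>+x. ennreal (norm (\<psi> x z)) \<partial>M) \<le> ennreal (real n)}" for n
    unfolding A_def p_def using int
    by (subst nn_integral_eq_integral) (auto intro!: integrable_norm simp: ennreal_le_iff)
  then have "closed (A n)" for n
    using closed_dual_integral_le[OF metrizable \<psi>] int by auto
  moreover have "(\<Union>n. A n) = UNIV"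
    unfolding A_def using real_arch_simple by blast
  ultimately obtain n where "interior (A n) \<noteq> {}"
    using baire_complete_metrizable_group[OF metrizable complete] by blast
  then obtain a where a: "a \<in> interior (A n)" by blast
  define U where "U = (\<lambda>u. u + a) -` interior (A n)"
  have U: "open U" "0 \<in> U"
    using a unfolding U_def by (auto intro!: open_vimage continuous_intros)
  have p_U: "p u \<le> 2 * real n" if "u \<in> U" for u
  proof -
    have "u + a \<in> A n" "a \<in> A n"
      using that a interior_subset[of "A n"] unfolding U_def by auto
    then show ?thesis using p_diff[of "u + a" a] by (simp add: A_def)
  qed
  have "continuous_on UNIV T"
    unfolding continuous_on_def
  proof (intro ballI)
    fix y
    have "\<forall>\<^sub>F z in nhds y. dist (T z) (T y) < e" if "e > 0" for e
    proof -
      \<comment> \<open>On the neighbourhood \<open>y + c\<^sup>-\<^sup>1 U\<close> of \<open>y\<close>, \<open>T\<close> varies by at most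
        \<open>2 n / c < e\<close>.\<close>
      define c where "c = (2 * real n + 1) / e"
      have c: "c > 0" "2 * real n < c * e" using \<open>e > 0\<close> by (auto simp: c_def)
      have cont: "continuous_on UNIV (\<lambda>z. smul (of_real c) (z - y))"
        using continuous_on_compose2[OF continuous_scale, of UNIV "\<lambda>z. (of_real c, z - y)"]
        by (simp add: continuous_on_Pair continuous_on_diff)
      have "open ((\<lambda>z. smul (of_real c) (z - y)) -` U)"
        using U(1) cont by (rule open_vimage)
      moreover have "dist (T z) (T y) < e" if "smul (of_real c) (z - y) \<in> U" for z
      proof -
        have "c * norm (T (z - y)) \<le> c * p (z - y)" using T_le c(1) by simp
        also have "\<dots> = p (smul (of_real c) (z - y))" using c(1) by (simp add: p_scale)
        also have "\<dots> < c * e" using p_U[OF that] c(2) by simp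
        finally show ?thesis using c(1) by (simp add: dist_norm T_diff)
      qed
      ultimately show ?thesis
        unfolding eventually_nhds using U(2)
        by (intro exI[of _ "(\<lambda>z. smul (of_real c) (z - y)) -` U"]) auto
    qed
    then have "(T \<longlongrightarrow> T y) (nhds y)" by (intro tendstoI)
    then show "(T \<longlongrightarrow> T y) (at y within UNIV)"
      by (rule tendsto_mono[OF at_within_le_nhds])
  qed
  moreover have "Vector_Spaces.linear smul (*) T"
    unfolding Vector_Spaces.linear_iff
    using T_add T_scale vector_space_axioms
    by (auto simp: vector_space_def algebra_simps)
  ultimately show ?thesis unfolding topological_dual_def T_def by blast
qed

section \<open>Fubini's theorem for the Gelfand integral\<close>


theorem theorem3p8:
  fixes smul :: "'k::real_or_complex \<Rightarrow> 'z \<Rightarrow> 'z::{ab_group_add, uniform_topological_group_add}"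
    and M1 :: "'a measure" and M2 :: "'b measure"
    and \<psi> :: "'a \<times> 'b \<Rightarrow> 'z \<Rightarrow> 'k"
  assumes "frechet_space smul"
    and "sigma_finite_measure M1" and "sigma_finite_measure M2"
    and "gelfand_integrable smul (M1 \<Otimes>\<^sub>M M2) \<psi>"
  shows "(\<forall>z. (AE x1 in M1. integrable M2 (\<lambda>x2. \<psi> (x1, x2) z)) \<and>
              integrable M1 (\<lambda>x1. LINT x2|M2. \<psi> (x1, x2) z)) \<and>
         (\<forall>z. (AE x2 in M2. integrable M1 (\<lambda>x1. \<psi> (x1, x2) z)) \<and>
              integrable M2 (\<lambda>x2. LINT x1|M1. \<psi> (x1, x2) z)) \<and>
         (\<lambda>z. LINT x1|M1. LINT x2|M2. \<psi> (x1, x2) z) \<in> topological_dual smul \<and>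
         gelfand_integral (M1 \<Otimes>\<^sub>M M2) (space (M1 \<Otimes>\<^sub>M M2)) \<psi> \<in> topological_dual smul \<and>
         (\<lambda>z. LINT x2|M2. LINT x1|M1. \<psi> (x1, x2) z) \<in> topological_dual smul \<and>
         (\<lambda>z. LINT x1|M1. LINT x2|M2. \<psi> (x1, x2) z) =
           gelfand_integral (M1 \<Otimes>\<^sub>M M2) (space (M1 \<Otimes>\<^sub>M M2)) \<psi> \<and>
         gelfand_integral (M1 \<Otimes>\<^sub>M M2) (space (M1 \<Otimes>\<^sub>M M2)) \<psi> =
           (\<lambda>z. LINT x2|M2. LINT x1|M1. \<psi> (x1, x2) z)"
proof -
  interpret M1: sigma_finite_measure M1 by fact
  interpret M2: sigma_finite_measure M2 by fact
  interpret pair_sigma_finite M1 M2 ..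
  let ?G = "gelfand_integral (M1 \<Otimes>\<^sub>M M2) (space (M1 \<Otimes>\<^sub>M M2)) \<psi>"
  have int: "integrable (M1 \<Otimes>\<^sub>M M2) (\<lambda>x. \<psi> x z)" for z
    using assms(4) unfolding gelfand_integrable_def by blast
  then have int': "integrable (M1 \<Otimes>\<^sub>M M2) (\<lambda>(x1, x2). \<psi> (x1, x2) z)" for z
    by (simp add: case_prod_unfold)
  have G: "?G z = (LINT x|(M1 \<Otimes>\<^sub>M M2). \<psi> x z)" for z
    unfolding gelfand_integral_def by (rule set_integral_space[OF int])
  have eq1: "(\<lambda>z. LINT x1|M1. LINT x2|M2. \<psi> (x1, x2) z) = ?G"
    by (intro ext) (simp only: G integral_fst'[OF int])
  have eq2: "?G = (\<lambda>z. LINT x2|M2. LINT x1|M1. \<psi> (x1, x2) z)"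
    by (intro ext) (simp add: G integral_snd[OF int'] case_prod_unfold)
  have dual: "?G \<in> topological_dual smul"
    using assms(1,4) by (rule gelfand_integral_in_topological_dual) simp
  show ?thesis
    unfolding eq1 eq2[symmetric]
    using dual AE_integrable_fst'[OF int] integrable_fst'[OF int]
      AE_integrable_snd[OF int'] integrable_snd[OF int'] by blast
qed

end
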